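(* Let $\alpha,\beta,\gamma,\delta\in\mathbb{R}$ with $\alpha+\delta\neq0$ and $\alpha\gamma=0$, and let $(G_7,g,J)$ be the connected, simply connected three-dimensional Lie group with left-invariant Lorentzian metric $g$ whose Lie algebra $\mathfrak{g}$ has a pseudo-orthonormal basis $\{e_1,e_2,e_3\}$ with $e_3$ timelike such that $$[e_1,e_2]=-\alpha e_1-\beta e_2-\beta e_3,\quad [e_1,e_3]=\alpha e_1+\beta e_2+\beta e_3,\quad [e_2,e_3]=\gamma e_1+\delta e_2+\delta e_3,$$ equipped with the product structure $Je_1=e_1$, $Je_2=e_2$, $Je_3=-e_3$. Let $c\in\mathbb{R}$. Then $(G_7,g,J)$ is a second kind algebraic Wanas soliton associated to the canonical connection $\nabla^0$ with constant $c$ (i.e. $\widetilde{\mathrm{Wan}}^0=c\,\mathrm{Id}+D$ with $D$ a derivation of $\mathfrak g$) if and only if $\alpha=\gamma=0$, $\beta^2+c=0$ and $\delta\neq0$. In particular, in this case $De_1=0$, $De_2=-(\beta^2+\delta^2)e_2-(\beta^2+\delta^2)e_3$, $De_3=(\beta^2+\delta^2)e_2+(\beta^2+\delta^2)e_3$.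
   Context: Pseudo-orthonormal with $e_3$ timelike means $g(e_1,e_1)=g(e_2,e_2)=1$, $g(e_3,e_3)=-1$, $g(e_i,e_j)=0$ for $i\ne j$. All tensors are left-invariant and evaluated on the Lie algebra $\mathfrak{g}$ of left-invariant vector fields. Let $\nabla$ be the Levi-Civita connection of $g$, and let $J$ be the product structure given in the claim, with $(\nabla_XJ)Y=\nabla_X(JY)-J(\nabla_XY)$. Canonical connection: $\nabla^0_XY=\nabla_XY-\frac12(\nabla_XJ)JY$. Curvature: $R^0(X,Y)Z=\nabla^0_X\nabla^0_YZ-\nabla^0_Y\nabla^0_XZ-\nabla^0_{[X,Y]}Z$. Torsion: $T^0(X,Y)=\nabla^0_XY-\nabla^0_YX-[X,Y]$. $A^0(X,Y)Z=T^0(T^0(X,Y),Z)$, and the Wanas tensor is $W^0(X,Y)Z=R^0(X,Y)Z-A^0(X,Y)Z$. $w^0(X,Y)=-g(W^0(X,e_1)Y,e_1)-g(W^0(X,e_2)Y,e_2)+g(W^0(X,e_3)Y,e_3)$. $\widetilde w^0(X,Y)=\frac12\big(w^0(X,Y)+w^0(Y,X)\big)$, and the operator $\widetilde{\mathrm{Wan}}^0:\mathfrak g\to\mathfrak g$ is defined by $\widetilde w^0(X,Y)=g(\widetilde{\mathrm{Wan}}^0(X),Y)$. A derivation of $\mathfrak g$ is a linear map $D$ with $D[X,Y]=[DX,Y]+[X,DY]$ for all $X,Y\in\mathfrak g$. $(G_7,g,J)$ is a second kind algebraic Wanas soliton associated to $\nabla^0$ (with constant $c$) if $\widetilde{\mathrm{Wan}}^0=c\,\mathrm{Id}+D$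 for the real number $c$ and a derivation $D$ of $\mathfrak g$. *)

theory Defs
  imports "HOL-Analysis.Analysis"
begin

text \<open>
  A left-invariant structure on a connected, simply connected Lie group is recorded by its values
  on the Lie algebra of left-invariant vector fields.  The Lie algebra is the whole type
  \<open>'a\<close> with bracket \<open>br\<close>; \<open>g\<close> is the metric and \<open>J\<close> the product structure on it.
\<close>

definition lie_algebra :: "('a::real_vector \<Rightarrow> 'a \<Rightarrow> 'a) \<Rightarrow> bool" where
  "lie_algebra br \<longleftrightarrow>
     bilinear br \<and> (\<forall>X. br X X = 0) \<and>
     (\<forall>X Y Z. br (br X Y) Z + br (br Y Z) X + br (br Z X) Y = 0)"

definition lie_derivation :: "('a::real_vector \<Rightarrow> 'a \<Rightarrow> 'a) \<Rightarrow> ('a \<Rightarrow> 'a) \<Rightarrow> bool" where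
  "lie_derivation br D \<longleftrightarrow> linear D \<and> (\<forall>X Y. D (br X Y) = br (D X) Y + br X (D Y))"

definition pseudo_riemannian_metric :: "('a::real_vector \<Rightarrow> 'a \<Rightarrow> real) \<Rightarrow> bool" where
  "pseudo_riemannian_metric g \<longleftrightarrow>
     bilinear g \<and> (\<forall>X Y. g X Y = g Y X) \<and> (\<forall>X. (\<forall>Y. g X Y = 0) \<longrightarrow> X = 0)"

text \<open>The existence of such a basis says that the space has dimension three and that \<open>g\<close> is
  Lorentzian, with signature \<open>(+, +, -)\<close>.\<close>

definition pseudo_orthonormal_basis ::
    "('a::real_vector \<Rightarrow> 'a \<Rightarrow> real) \<Rightarrow> 'a \<Rightarrow> 'a \<Rightarrow> 'a \<Rightarrow> bool" where
  "pseudo_orthonormal_basis g e1 e2 e3 \<longleftrightarrow>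
     distinct [e1, e2, e3] \<and> independent {e1, e2, e3} \<and> span {e1, e2, e3} = UNIV \<and>
     g e1 e1 = 1 \<and> g e2 e2 = 1 \<and> g e3 e3 = -1 \<and>
     g e1 e2 = 0 \<and> g e1 e3 = 0 \<and> g e2 e3 = 0"

text \<open>The second conjunct is vanishing torsion.  In the third, \<open>g Y Z\<close> is a constant function on
  the group for left-invariant \<open>Y\<close> and \<open>Z\<close>, so the term \<open>X (g Y Z)\<close> of metric compatibility
  is zero.\<close>

definition is_levi_civita ::
    "('a::real_vector \<Rightarrow> 'a \<Rightarrow> 'a) \<Rightarrow> ('a \<Rightarrow> 'a \<Rightarrow> real) \<Rightarrow> ('a \<Rightarrow> 'a \<Rightarrow> 'a) \<Rightarrow> bool" where
  "is_levi_civita br g nab \<longleftrightarrow>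
     bilinear nab \<and>
     (\<forall>X Y. nab X Y - nab Y X = br X Y) \<and>
     (\<forall>X Y Z. g (nab X Y) Z + g Y (nab X Z) = 0)"

definition levi_civita ::
    "('a::real_vector \<Rightarrow> 'a \<Rightarrow> 'a) \<Rightarrow> ('a \<Rightarrow> 'a \<Rightarrow> real) \<Rightarrow> 'a \<Rightarrow> 'a \<Rightarrow> 'a" where
  "levi_civita br g = (THE nab. is_levi_civita br g nab)"

definition nabla_J ::
    "('a::real_vector \<Rightarrow> 'a \<Rightarrow> 'a) \<Rightarrow> ('a \<Rightarrow> 'a) \<Rightarrow> 'a \<Rightarrow> 'a \<Rightarrow> 'a" where
  "nabla_J nab J X Y = nab X (J Y) - J (nab X Y)"

definition canonical_connection ::
    "('a::real_vector \<Rightarrow> 'a \<Rightarrow> 'a) \<Rightarrow> ('a \<Rightarrow> 'a \<Rightarrow> real) \<Rightarrow> ('a \<Rightarrow> 'a) \<Rightarrow> 'a \<Rightarrow> 'a \<Rightarrow> 'a" where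
  "canonical_connection br g J X Y =
     levi_civita br g X Y - (1/2) *\<^sub>R nabla_J (levi_civita br g) J X (J Y)"

definition connection_curvature ::
    "('a::real_vector \<Rightarrow> 'a \<Rightarrow> 'a) \<Rightarrow> ('a \<Rightarrow> 'a \<Rightarrow> 'a) \<Rightarrow> 'a \<Rightarrow> 'a \<Rightarrow> 'a \<Rightarrow> 'a" where
  "connection_curvature br nab X Y Z =
     nab X (nab Y Z) - nab Y (nab X Z) - nab (br X Y) Z"

definition connection_torsion ::
    "('a::real_vector \<Rightarrow> 'a \<Rightarrow> 'a) \<Rightarrow> ('a \<Rightarrow> 'a \<Rightarrow> 'a) \<Rightarrow> 'a \<Rightarrow> 'a \<Rightarrow> 'a" where
  "connection_torsion br nab X Y = nab X Y - nab Y X - br X Y"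

definition wanas_tensor ::
    "('a::real_vector \<Rightarrow> 'a \<Rightarrow> 'a) \<Rightarrow> ('a \<Rightarrow> 'a \<Rightarrow> 'a) \<Rightarrow> 'a \<Rightarrow> 'a \<Rightarrow> 'a \<Rightarrow> 'a" where
  "wanas_tensor br nab X Y Z =
     connection_curvature br nab X Y Z
     - connection_torsion br nab (connection_torsion br nab X Y) Z"

definition wanas_contraction ::
    "('a::real_vector \<Rightarrow> 'a \<Rightarrow> 'a) \<Rightarrow> ('a \<Rightarrow> 'a \<Rightarrow> real) \<Rightarrow> ('a \<Rightarrow> 'a \<Rightarrow> 'a) \<Rightarrow>
     'a \<Rightarrow> 'a \<Rightarrow> 'a \<Rightarrow> 'a \<Rightarrow> 'a \<Rightarrow> real" where
  "wanas_contraction br g nab e1 e2 e3 X Y =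
     - g (wanas_tensor br nab X e1 Y) e1
     - g (wanas_tensor br nab X e2 Y) e2
     + g (wanas_tensor br nab X e3 Y) e3"

definition sym_wanas_contraction ::
    "('a::real_vector \<Rightarrow> 'a \<Rightarrow> 'a) \<Rightarrow> ('a \<Rightarrow> 'a \<Rightarrow> real) \<Rightarrow> ('a \<Rightarrow> 'a \<Rightarrow> 'a) \<Rightarrow>
     'a \<Rightarrow> 'a \<Rightarrow> 'a \<Rightarrow> 'a \<Rightarrow> 'a \<Rightarrow> real" where
  "sym_wanas_contraction br g nab e1 e2 e3 X Y =
     (1/2) * (wanas_contraction br g nab e1 e2 e3 X Y + wanas_contraction br g nab e1 e2 e3 Y X)"

definition sym_wanas_operator ::
    "('a::real_vector \<Rightarrow> 'a \<Rightarrow> 'a) \<Rightarrow> ('a \<Rightarrow> 'a \<Rightarrow> real) \<Rightarrow> ('a \<Rightarrow> 'a \<Rightarrow> 'a) \<Rightarrow>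
     'a \<Rightarrow> 'a \<Rightarrow> 'a \<Rightarrow> 'a \<Rightarrow> 'a" where
  "sym_wanas_operator br g nab e1 e2 e3 =
     (THE A. \<forall>X Y. sym_wanas_contraction br g nab e1 e2 e3 X Y = g (A X) Y)"

definition wanas_soliton_decomposition ::
    "('a::real_vector \<Rightarrow> 'a \<Rightarrow> 'a) \<Rightarrow> ('a \<Rightarrow> 'a \<Rightarrow> real) \<Rightarrow> ('a \<Rightarrow> 'a \<Rightarrow> 'a) \<Rightarrow>
     'a \<Rightarrow> 'a \<Rightarrow> 'a \<Rightarrow> real \<Rightarrow> ('a \<Rightarrow> 'a) \<Rightarrow> bool" where
  "wanas_soliton_decomposition br g nab e1 e2 e3 c D \<longleftrightarrow>
     lie_derivation br D \<and> (\<forall>X. sym_wanas_operator br g nab e1 e2 e3 X = c *\<^sub>R X + D X)"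

definition second_kind_algebraic_wanas_soliton ::
    "('a::real_vector \<Rightarrow> 'a \<Rightarrow> 'a) \<Rightarrow> ('a \<Rightarrow> 'a \<Rightarrow> real) \<Rightarrow> ('a \<Rightarrow> 'a \<Rightarrow> 'a) \<Rightarrow>
     'a \<Rightarrow> 'a \<Rightarrow> 'a \<Rightarrow> real \<Rightarrow> bool" where
  "second_kind_algebraic_wanas_soliton br g nab e1 e2 e3 c \<longleftrightarrow>
     (\<exists>D. wanas_soliton_decomposition br g nab e1 e2 e3 c D)"

end

theory Submission
  imports Defs
begin

text \<open>
  The connection \<open>\<nabla>\<^sup>0\<close> preserves both eigenspaces of \<open>J\<close>, so it annihilates \<open>e3\<close> and acts on the
  plane of \<open>e1, e2\<close> by infinitesimal rotations: \<open>\<nabla>\<^sup>0\<^sub>X e1 = \<theta>(X) e2\<close> and \<open>\<nabla>\<^sup>0\<^sub>X e2 = - \<theta>(X) e1\<close>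
  for a linear form \<open>\<theta>\<close>.  Hence the curvature is \<open>- \<theta>([X,Y])\<close> times the rotation generator, and the
  Wanas operator is an explicit matrix.  Since \<open>[e1,e2] + [e1,e3] = 0\<close>, adding the \<open>e1\<close>-components
  of the derivation identity for these two brackets eliminates \<open>c\<close> and leaves
  \<open>4 \<alpha>\<^sup>3 + \<gamma>\<^sup>2 \<delta> = 0\<close>.  With \<open>\<alpha> \<gamma> = 0\<close> and \<open>\<alpha> + \<delta> \<noteq> 0\<close> this forces \<open>\<alpha> = \<gamma> = 0\<close>, and then
  the bracket \<open>[e2,e3]\<close> yields \<open>c = - \<beta>\<^sup>2\<close>.
\<close>

section \<open>Uniqueness from nondegeneracy of the metric\<close>

lemma metric_eqI:
  assumes "pseudo_riemannian_metric g" and "\<And>Z. g X Z = g Y Z"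
  shows "X = Y"
proof -
  have "bilinear g"
    using assms(1) by (simp add: pseudo_riemannian_metric_def)
  then have "g (X - Y) Z = 0" for Z
    by (simp add: bilinear_lsub assms(2))
  then show ?thesis
    using assms(1) by (metis pseudo_riemannian_metric_def eq_iff_diff_eq_0)
qed

text \<open>Vanishing torsion turns each bracket into a difference of covariant derivatives;
  compatibility then cancels four of the six terms and merges the other two. The right side is free
  of \<open>nab\<close>, so bracket and metric determine the connection.\<close>

lemma koszul_formula:
  assumes g: "pseudo_riemannian_metric g" and lc: "is_levi_civita br g nab"
  shows "2 * g (nab X Y) Z = g (br X Y) Z - g (br Y Z) X + g (br Z X) Y"
proof -
  have sym: "g U V = g V U" for U V
    using g by (simp add: pseudo_riemannian_metric_def)
  have tors: "g (br U V) T = g (nab U V) T - g (nab V U) T" for U V T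
  proof -
    have "br U V = nab U V - nab V U"
      using lc by (simp add: is_levi_civita_def)
    moreover have "bilinear g"
      using g by (simp add: pseudo_riemannian_metric_def)
    ultimately show ?thesis
      by (simp add: bilinear_lsub)
  qed
  have comp: "g (nab U V) T = - g (nab U T) V" for U V T
    using lc sym[of V] unfolding is_levi_civita_def by (metis eq_neg_iff_add_eq_0)
  show ?thesis
    using comp[of X Y Z] comp[of Y X Z] comp[of Z X Y] by (simp add: tors)
qed

lemma levi_civita_eqI:
  assumes g: "pseudo_riemannian_metric g" and lc: "is_levi_civita br g nab"
  shows "levi_civita br g = nab"
  unfolding levi_civita_def
proof (rule the_equality)
  fix nab' assume lc': "is_levi_civita br g nab'"
  show "nab' = nab"
  proof (intro ext metric_eqI[OF g])
    fix X Y Z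
    show "g (nab' X Y) Z = g (nab X Y) Z"
      using koszul_formula[OF g lc, of X Y Z] koszul_formula[OF g lc', of X Y Z] by simp
  qed
qed (rule lc)

lemma sym_wanas_operator_eqI:
  assumes g: "pseudo_riemannian_metric g"
    and A: "\<And>X Y. sym_wanas_contraction br g nab e1 e2 e3 X Y = g (A X) Y"
  shows "sym_wanas_operator br g nab e1 e2 e3 = A"
  unfolding sym_wanas_operator_def
  by (rule the_equality) (use A in \<open>auto intro!: ext metric_eqI[OF g]\<close>)

section \<open>Coordinates in a pseudo-orthonormal frame\<close>

locale pseudo_orthonormal_frame =
  fixes g :: "'a::real_vector \<Rightarrow> 'a \<Rightarrow> real" and e1 e2 e3 :: 'a
  assumes metric: "pseudo_riemannian_metric g"
    and basis: "pseudo_orthonormal_basis g e1 e2 e3"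
begin

definition frame_vec :: "real \<Rightarrow> real \<Rightarrow> real \<Rightarrow> 'a" where
  "frame_vec x y z = x *\<^sub>R e1 + y *\<^sub>R e2 + z *\<^sub>R e3"

lemma basis_vec: "e1 = frame_vec 1 0 0" "e2 = frame_vec 0 1 0" "e3 = frame_vec 0 0 1"
  by (simp_all add: frame_vec_def)

lemma vec_arith:
  "frame_vec x y z + frame_vec x' y' z' = frame_vec (x + x') (y + y') (z + z')"
  "frame_vec x y z - frame_vec x' y' z' = frame_vec (x - x') (y - y') (z - z')"
  "- frame_vec x y z = frame_vec (- x) (- y) (- z)"
  "r *\<^sub>R frame_vec x y z = frame_vec (r * x) (r * y) (r * z)"
  "0 = frame_vec 0 0 0"
  by (simp_all add: frame_vec_def algebra_simps)

lemma bilinear_metric: "bilinear g" and metric_sym: "g X Y = g Y X"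
  using metric by (simp_all add: pseudo_riemannian_metric_def)

lemmas metric_bilinear_simps =
  bilinear_metric[THEN bilinear_ladd] bilinear_metric[THEN bilinear_radd]
  bilinear_metric[THEN bilinear_lmul] bilinear_metric[THEN bilinear_rmul]

lemma metric_vec: "g (frame_vec x y z) (frame_vec x' y' z') = x * x' + y * y' - z * z'"
proof -
  have "g e1 e1 = 1" "g e2 e2 = 1" "g e3 e3 = -1" "g e1 e2 = 0" "g e1 e3 = 0" "g e2 e3 = 0"
    "g e2 e1 = 0" "g e3 e1 = 0" "g e3 e2 = 0"
    using basis metric_sym by (auto simp: pseudo_orthonormal_basis_def)
  then show ?thesis
    by (simp add: frame_vec_def metric_bilinear_simps)
qed

text \<open>Components are read off with the metric, so they inherit linearity from
  \<open>g\<close>; the sign in \<open>coord3\<close> compensates for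
  \<open>g e3 e3 = -1\<close>.\<close>

definition coord1 :: "'a \<Rightarrow> real" where "coord1 X = g X e1"
definition coord2 :: "'a \<Rightarrow> real" where "coord2 X = g X e2"
definition coord3 :: "'a \<Rightarrow> real" where "coord3 X = - g X e3"

lemma coord_vec [simp]:
  "coord1 (frame_vec x y z) = x" "coord2 (frame_vec x y z) = y" "coord3 (frame_vec x y z) = z"
  using metric_vec[of x y z 1 0 0] metric_vec[of x y z 0 1 0] metric_vec[of x y z 0 0 1]
  by (simp_all add: coord1_def coord2_def coord3_def flip: basis_vec)

lemma vec_eq_iff: "frame_vec x y z = frame_vec x' y' z' \<longleftrightarrow> x = x' \<and> y = y' \<and> z = z'"
  by (metis coord_vec)

lemma vec_surj: obtains x y z where "X = frame_vec x y z"
proof -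
  have "X \<in> span {e1, e2, e3}"
    using basis by (simp add: pseudo_orthonormal_basis_def)
  then obtain x y z where "X = x *\<^sub>R e1 + (y *\<^sub>R e2 + z *\<^sub>R e3)"
    by (auto simp: span_breakdown_eq algebra_simps)
  then show thesis
    using that by (simp add: frame_vec_def add.assoc)
qed

lemma coord_linear:
  "coord1 (X + Y) = coord1 X + coord1 Y" "coord1 (r *\<^sub>R X) = r * coord1 X"
  "coord2 (X + Y) = coord2 X + coord2 Y" "coord2 (r *\<^sub>R X) = r * coord2 X"
  "coord3 (X + Y) = coord3 X + coord3 Y" "coord3 (r *\<^sub>R X) = r * coord3 X"
  by (simp_all add: coord1_def coord2_def coord3_def metric_bilinear_simps)

end

section \<open>The Lie algebra and its Levi-Civita connection\<close>

locale g7 = pseudo_orthonormal_frame g e1 e2 e3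
  for g :: "'a::real_vector \<Rightarrow> 'a \<Rightarrow> real" and e1 e2 e3 :: 'a +
  fixes br :: "'a \<Rightarrow> 'a \<Rightarrow> 'a" and J :: "'a \<Rightarrow> 'a" and \<alpha> \<beta> \<gamma> \<delta> :: real
  assumes lie: "lie_algebra br"
    and br12: "br e1 e2 = - \<alpha> *\<^sub>R e1 - \<beta> *\<^sub>R e2 - \<beta> *\<^sub>R e3"
    and br13: "br e1 e3 = \<alpha> *\<^sub>R e1 + \<beta> *\<^sub>R e2 + \<beta> *\<^sub>R e3"
    and br23: "br e2 e3 = \<gamma> *\<^sub>R e1 + \<delta> *\<^sub>R e2 + \<delta> *\<^sub>R e3"
    and lin_J: "linear J" and J_basis: "J e1 = e1" "J e2 = e2" "J e3 = - e3"
    and alpha_gamma: "\<alpha> * \<gamma> = 0"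
begin

lemma bracket_vec:
  "br (frame_vec x y z) (frame_vec x' y' z') =
     frame_vec (- \<alpha> * (x * y' - y * x') + \<alpha> * (x * z' - z * x') + \<gamma> * (y * z' - z * y'))
         (- \<beta> * (x * y' - y * x') + \<beta> * (x * z' - z * x') + \<delta> * (y * z' - z * y'))
         (- \<beta> * (x * y' - y * x') + \<beta> * (x * z' - z * x') + \<delta> * (y * z' - z * y'))"
proof -
  have bil: "bilinear br" and alt: "br X X = 0" for X
    using lie by (simp_all add: lie_algebra_def)
  note bil_simps = bil[THEN bilinear_ladd] bil[THEN bilinear_radd]
    bil[THEN bilinear_lmul] bil[THEN bilinear_rmul]
  have anti: "br Y X = - br X Y" for X Y
    using alt[of "X + Y"] alt[of X] alt[of Y]
    by (simp add: bil_simps eq_neg_iff_add_eq_0 add.commute)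
  show ?thesis
    by (simp add: frame_vec_def bil_simps alt br12 br13 br23
        anti[of e2 e1] anti[of e3 e1] anti[of e3 e2] algebra_simps)
qed

lemma J_vec: "J (frame_vec x y z) = frame_vec x y (- z)"
  by (simp add: frame_vec_def linear_add[OF lin_J] linear_scale[OF lin_J] J_basis)

text \<open>The connection form g(\<nabla>_X e1, e2) of the Levi-Civita connection, as given by the
  Koszul formula.\<close>

definition theta :: "real \<Rightarrow> real \<Rightarrow> real \<Rightarrow> real" where
  "theta x y z = \<alpha> * x + \<beta> * y + (\<gamma> / 2 - \<beta>) * z"

text \<open>The explicit solution of the Koszul formula. Each X acts by an element of so(2,1):
  \<open>theta\<close> rotates the plane of \<open>e1, e2\<close>, while \<open>q\<close> and
  \<open>r\<close> are boosts into the timelike \<open>e3\<close> and hence enter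
  symmetrically.\<close>

definition lc_connection :: "'a \<Rightarrow> 'a \<Rightarrow> 'a" where
  "lc_connection X Y =
    (let x = coord1 X; y = coord2 X; z = coord3 X;
         q = \<alpha> * x + (\<beta> + \<gamma> / 2) * y - \<beta> * z;
         r = \<gamma> / 2 * x + \<delta> * y - \<delta> * z
     in frame_vec (- theta x y z * coord2 Y + q * coord3 Y)
            (theta x y z * coord1 Y + r * coord3 Y)
            (q * coord1 Y + r * coord2 Y))"

lemma is_levi_civita_lc_connection: "is_levi_civita br g lc_connection"
  unfolding is_levi_civita_def
proof (intro conjI allI)
  show "bilinear lc_connection"
    unfolding bilinear_def
    by (auto intro!: linearI simp: lc_connection_def Let_def theta_def coord_linear vec_arith
        vec_eq_iff field_simps)
next
  fix X Y
  show "lc_connection X Y - lc_connection Y X = br X Y"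
    by (rule vec_surj[of X], rule vec_surj[of Y])
      (simp add: lc_connection_def Let_def theta_def bracket_vec vec_arith vec_eq_iff field_simps)
next
  fix X Y Z
  show "g (lc_connection X Y) Z + g Y (lc_connection X Z) = 0"
    by (rule vec_surj[of X], rule vec_surj[of Y], rule vec_surj[of Z])
      (simp add: lc_connection_def Let_def metric_vec algebra_simps)
qed

section \<open>The canonical connection and its Wanas operator\<close>

abbreviation nabla0 :: "'a \<Rightarrow> 'a \<Rightarrow> 'a" where
  "nabla0 \<equiv> canonical_connection br g J"

text \<open>Since \<open>J\<close> is an involution, \<open>nabla0 X\<close> is the average of
  \<nabla>_X and J \<nabla>_X J. Conjugation by \<open>J\<close> keeps the rotation and reverses
  both boosts, so only \<open>theta\<close> survives.\<close>

lemma nabla0_vec: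
  "nabla0 (frame_vec x y z) (frame_vec x' y' z') = frame_vec (- theta x y z * y') (theta x y z * x') 0"
  by (simp add: canonical_connection_def nabla_J_def J_vec vec_arith vec_eq_iff lc_connection_def
      Let_def levi_civita_eqI[OF metric is_levi_civita_lc_connection] field_simps)

text \<open>Self-adjointness for a Lorentzian metric explains the opposite signs of \<open>p\<close>
  and \<open>q\<close> in the \<open>e3\<close> row and column. The entries are already reduced by
  \<alpha> \<gamma> = 0.\<close>

definition wanas_matrix :: "'a \<Rightarrow> 'a" where
  "wanas_matrix X =
    (let x = coord1 X; y = coord2 X; z = coord3 X;
         p = \<alpha> * \<beta> + \<gamma> * \<delta> / 4; q = \<alpha>\<^sup>2 / 2 + 3 / 4 * \<beta> * \<gamma> + \<beta>\<^sup>2 + \<delta>\<^sup>2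
     in frame_vec ((\<beta> * \<gamma> / 2 - \<alpha>\<^sup>2 - \<beta>\<^sup>2) * x - \<alpha> * \<beta> * y + p * z)
            (- \<alpha> * \<beta> * x - (\<alpha>\<^sup>2 + 3 / 2 * \<beta> * \<gamma> + 2 * \<beta>\<^sup>2 + \<delta>\<^sup>2) * y + q * z)
            (- p * x - q * y + (\<alpha>\<^sup>2 + \<beta> * \<gamma> + \<gamma>\<^sup>2 / 2 + \<delta>\<^sup>2) * z))"

lemma wanas_matrix_linear:
  "wanas_matrix (X + Y) = wanas_matrix X + wanas_matrix Y"
  "wanas_matrix (r *\<^sub>R X) = r *\<^sub>R wanas_matrix X"
  by (simp_all add: wanas_matrix_def Let_def coord_linear vec_arith vec_eq_iff field_simps)

lemma sym_wanas_contraction: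
  "sym_wanas_contraction br g nabla0 e1 e2 e3 X Y = g (wanas_matrix X) Y"
proof (rule vec_surj[of X], rule vec_surj[of Y])
  fix x y z x' y' z' assume X: "X = frame_vec x y z" and Y: "Y = frame_vec x' y' z'"
  have contraction: "wanas_contraction br g nabla0 e1 e2 e3 U V =
      - g (wanas_tensor br nabla0 U (frame_vec 1 0 0) V) (frame_vec 1 0 0)
      - g (wanas_tensor br nabla0 U (frame_vec 0 1 0) V) (frame_vec 0 1 0)
      + g (wanas_tensor br nabla0 U (frame_vec 0 0 1) V) (frame_vec 0 0 1)" for U V
    by (simp only: wanas_contraction_def flip: basis_vec)
  \<comment> \<open>The contraction produces multiples of \<alpha> \<gamma>, such as - \<alpha>
    \<gamma> / 2 at \<open>e1, e3\<close>, that the matrix omits; they vanish in either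
    case.\<close>
  have "\<alpha> = 0 \<or> \<gamma> = 0" using alpha_gamma by simp
  then show "sym_wanas_contraction br g nabla0 e1 e2 e3 X Y = g (wanas_matrix X) Y"
    unfolding X Y
    by (auto simp: sym_wanas_contraction_def contraction wanas_tensor_def
        connection_curvature_def connection_torsion_def nabla0_vec bracket_vec vec_arith
        metric_vec theta_def wanas_matrix_def Let_def field_simps power2_eq_square)
qed

lemma sym_wanas_operator: "sym_wanas_operator br g nabla0 e1 e2 e3 = wanas_matrix"
  by (rule sym_wanas_operator_eqI[OF metric sym_wanas_contraction])

section \<open>The soliton equation and its solutions\<close>

lemma wanas_matrix_vec:
  assumes "\<alpha> = 0" and "\<gamma> = 0"
  shows "wanas_matrix (frame_vec x y z) =
    frame_vec (- \<beta>\<^sup>2 * x) (- (2 * \<beta>\<^sup>2 + \<delta>\<^sup>2) * y + (\<beta>\<^sup>2 + \<delta>\<^sup>2) * z)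
      (- (\<beta>\<^sup>2 + \<delta>\<^sup>2) * y + \<delta>\<^sup>2 * z)"
  by (simp only: wanas_matrix_def Let_def coord_vec vec_eq_iff, simp add: assms algebra_simps)

lemma soliton_parameters:
  assumes sol: "wanas_soliton_decomposition br g nabla0 e1 e2 e3 c D" and "\<alpha> + \<delta> \<noteq> 0"
  shows "\<alpha> = 0" "\<gamma> = 0" "\<beta>\<^sup>2 + c = 0" "\<delta> \<noteq> 0"
proof -
  \<comment> \<open>\<open>D\<close> is forced, so only its derivation identity on the three basis
    brackets has to be examined.\<close>
  have D: "D X = wanas_matrix X - c *\<^sub>R X" for X
    using sol by (simp add: wanas_soliton_decomposition_def sym_wanas_operator)
  have der: "D (br X Y) = br (D X) Y + br X (D Y)" for X Y
    using sol by (simp add: wanas_soliton_decomposition_def lie_derivation_def)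
  note expand = D wanas_matrix_def Let_def bracket_vec vec_arith vec_eq_iff coord_vec
  note e12 = der[of "frame_vec 1 0 0" "frame_vec 0 1 0", unfolded expand]
    and e13 = der[of "frame_vec 1 0 0" "frame_vec 0 0 1", unfolded expand]
    and e23 = der[of "frame_vec 0 1 0" "frame_vec 0 0 1", unfolded expand]
  have "\<alpha> = 0 \<and> \<gamma> = 0"
  proof (cases "\<alpha> = 0")
    case True
    with e12 e13 have "\<gamma>\<^sup>2 * \<delta> = 0"
      by simp algebra
    with True \<open>\<alpha> + \<delta> \<noteq> 0\<close> show ?thesis by simp
  next
    case False
    with alpha_gamma have "\<gamma> = 0" by simp
    with e12 e13 have "\<alpha> ^ 3 = 0"
      by simp algebra
    with False show ?thesis by simp
  qed
  then show "\<alpha> = 0" "\<gamma> = 0" by simp_all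
  with \<open>\<alpha> + \<delta> \<noteq> 0\<close> show "\<delta> \<noteq> 0" by simp
  \<comment> \<open>Here [e2,e3] = \<delta> (e2 + e3). \<open>D\<close> multiplies this vector by -
    (\<open>\<beta>\<^sup>2\<close> + c), whereas the right side multiplies it by the trace of
    \<open>D\<close> on the plane of \<open>e2, e3\<close>, which is twice that factor.\<close>
  from e23 have "\<delta> * (\<beta>\<^sup>2 + c) = 0"
    by (simp add: \<open>\<alpha> = 0\<close> \<open>\<gamma> = 0\<close>) algebra
  with \<open>\<delta> \<noteq> 0\<close> show "\<beta>\<^sup>2 + c = 0" by simp
qed

text \<open>Both sides of the derivation identity vanish: every bracket is a multiple of e2 + e3,
  which the operator kills, and on the right [e1, e2 + e3] = 0 while the operator has trace zero on
  the plane of \<open>e2, e3\<close>.\<close>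

lemma soliton_exists:
  assumes "\<alpha> = 0" and "\<gamma> = 0" and c: "\<beta>\<^sup>2 + c = 0"
  shows "wanas_soliton_decomposition br g nabla0 e1 e2 e3 c (\<lambda>X. wanas_matrix X - c *\<^sub>R X)"
proof -
  have c: "c = - \<beta>\<^sup>2" using c by simp
  have "linear (\<lambda>X. wanas_matrix X - c *\<^sub>R X)"
    by (auto intro!: linearI simp: wanas_matrix_linear algebra_simps)
  moreover have "wanas_matrix (br X Y) - c *\<^sub>R br X Y =
      br (wanas_matrix X - c *\<^sub>R X) Y + br X (wanas_matrix Y - c *\<^sub>R Y)" for X Y
    by (rule vec_surj[of X], rule vec_surj[of Y])
      (simp only: wanas_matrix_vec[OF assms(1,2)] bracket_vec vec_arith vec_eq_iff c,
        simp add: assms(1,2) algebra_simps)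
  ultimately show ?thesis
    by (simp add: wanas_soliton_decomposition_def lie_derivation_def sym_wanas_operator)
qed

lemma soliton_derivation:
  assumes sol: "wanas_soliton_decomposition br g nabla0 e1 e2 e3 c D" and "\<alpha> + \<delta> \<noteq> 0"
  shows "D e1 = 0"
    and "D e2 = - (\<beta>\<^sup>2 + \<delta>\<^sup>2) *\<^sub>R e2 - (\<beta>\<^sup>2 + \<delta>\<^sup>2) *\<^sub>R e3"
    and "D e3 = (\<beta>\<^sup>2 + \<delta>\<^sup>2) *\<^sub>R e2 + (\<beta>\<^sup>2 + \<delta>\<^sup>2) *\<^sub>R e3"
proof -
  note par = soliton_parameters[OF assms]
  have c: "c = - \<beta>\<^sup>2" using par(3) by simp
  have "D X = wanas_matrix X - c *\<^sub>R X" for X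
    using sol by (simp add: wanas_soliton_decomposition_def sym_wanas_operator)
  \<comment> \<open>\<open>D\<close> depends only on y - z and takes values on the null line of e2 +
    e3, so it squares to zero.\<close>
  then have D: "D (frame_vec x y z) =
      frame_vec 0 (- (\<beta>\<^sup>2 + \<delta>\<^sup>2) * (y - z)) (- (\<beta>\<^sup>2 + \<delta>\<^sup>2) * (y - z))" for x y z
    by (simp add: c wanas_matrix_vec[OF par(1,2)] vec_arith vec_eq_iff algebra_simps)
  show "D e1 = 0"
    and "D e2 = - (\<beta>\<^sup>2 + \<delta>\<^sup>2) *\<^sub>R e2 - (\<beta>\<^sup>2 + \<delta>\<^sup>2) *\<^sub>R e3"
    and "D e3 = (\<beta>\<^sup>2 + \<delta>\<^sup>2) *\<^sub>R e2 + (\<beta>\<^sup>2 + \<delta>\<^sup>2) *\<^sub>R e3"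
    using D[of 1 0 0] D[of 0 1 0] D[of 0 0 1] by (simp_all add: frame_vec_def algebra_simps)
qed

end

theorem theorem3p11:
  fixes br :: "'a::real_vector \<Rightarrow> 'a \<Rightarrow> 'a"
    and g :: "'a \<Rightarrow> 'a \<Rightarrow> real"
    and J :: "'a \<Rightarrow> 'a"
    and e1 e2 e3 :: 'a
    and \<alpha> \<beta> \<gamma> \<delta> c :: real
  assumes "\<alpha> + \<delta> \<noteq> 0" and "\<alpha> * \<gamma> = 0"
    and "lie_algebra br"
    and "pseudo_riemannian_metric g"
    and "pseudo_orthonormal_basis g e1 e2 e3"
    and "br e1 e2 = - \<alpha> *\<^sub>R e1 - \<beta> *\<^sub>R e2 - \<beta> *\<^sub>R e3"
    and "br e1 e3 = \<alpha> *\<^sub>R e1 + \<beta> *\<^sub>R e2 + \<beta> *\<^sub>R e3"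
    and "br e2 e3 = \<gamma> *\<^sub>R e1 + \<delta> *\<^sub>R e2 + \<delta> *\<^sub>R e3"
    and "linear J" and "J e1 = e1" and "J e2 = e2" and "J e3 = - e3"
  shows "(second_kind_algebraic_wanas_soliton br g (canonical_connection br g J) e1 e2 e3 c
            \<longleftrightarrow> \<alpha> = 0 \<and> \<gamma> = 0 \<and> \<beta>\<^sup>2 + c = 0 \<and> \<delta> \<noteq> 0)
       \<and> (\<forall>D. wanas_soliton_decomposition br g (canonical_connection br g J) e1 e2 e3 c D \<longrightarrow>
            D e1 = 0 \<and>
            D e2 = - (\<beta>\<^sup>2 + \<delta>\<^sup>2) *\<^sub>R e2 - (\<beta>\<^sup>2 + \<delta>\<^sup>2) *\<^sub>R e3 \<and>
            D e3 = (\<beta>\<^sup>2 + \<delta>\<^sup>2) *\<^sub>R e2 + (\<beta>\<^sup>2 + \<delta>\<^sup>2) *\<^sub>R e3)"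
proof -
  interpret g7 g e1 e2 e3 br J \<alpha> \<beta> \<gamma> \<delta>
    by (intro g7.intro pseudo_orthonormal_frame.intro g7_axioms.intro) (fact assms)+
  show ?thesis
    unfolding second_kind_algebraic_wanas_soliton_def
    using soliton_parameters soliton_exists soliton_derivation \<open>\<alpha> + \<delta> \<noteq> 0\<close> by blast
qed

end
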